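(* For every ideal $J$ on $\omega$, $\mathrm{cov}(\mathcal{N})\le\mathrm{cov}(\mathcal{N}_J)\le\mathrm{cov}(\mathcal{N}^*_J)\le\mathrm{cov}(\mathcal{E})\le\min\{\mathrm{cof}(\mathcal{M}),\mathfrak{r}\}$ and $\max\{\mathrm{add}(\mathcal{M}),\mathfrak{s}\}\le\mathrm{non}(\mathcal{E})\le\mathrm{non}(\mathcal{N}^*_J)\le\mathrm{non}(\mathcal{N}_J)\le\mathrm{non}(\mathcal{N})$.
   Context: An ideal on $\omega$ is a family $J\subseteq\mathcal{P}(\omega)$ closed under subsets and finite unions, containing all finite sets, with $\omega\notin J$; $J^+=\mathcal{P}(\omega)\setminus J$, $J^d=\{\omega\setminus a:a\in J\}$. ${}^\omega2$ has Lebesgue measure $\mu$; $\Omega$ is the set of clopen subsets. For $\bar c\in{}^\omega\Omega$: $N(\bar c)=\{x:x\in c_n\text{ for infinitely many }n\}$, $\overline{\Omega}=\{\bar c:\mu(N(\bar c))=0\}$, $N_J(\bar c)=\{x:\{n:x\in c_n\}\in J^+\}$, $N^*_J(\bar c)=\{x:\{n:x\in c_n\}\in J^d\}$, $\mathcal{N}_J=\{X\subseteq{}^\omega2:\exists\bar c\in\overline{\Omega}\ X\subseteq N_J(\bar c)\}$, $\mathcal{N}^*_J=\{X:\exists\bar c\in\overline{\Omega}\ X\subseteq N^*_J(\bar c)\}$. $\mathcal{N}$, $\mathcal{M}$ are the null and meager ideals on ${}^\omega2$, $\mathcal{E}$ is the $\sigma$-ideal generated by closed null sets. For an ideal $\mathcal{I}$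 on a set $X$: $\mathrm{add}$, $\mathrm{cov}$, $\mathrm{non}$, $\mathrm{cof}$ denote its additivity, covering number, uniformity and cofinality. $\mathfrak{s}$ is the splitting number and $\mathfrak{r}$ the reaping number. *)

theory Defs
  imports "HOL-Probability.Probability"
begin

unbundle cardinal_syntax

section \<open>Cardinal numbers\<close>

text \<open>
  Cardinals are represented, as in the HOL cardinal library, by (well-order relations of) the form
  \<open>|A|\<close> and compared across types by \<open>\<le>o\<close>. The cardinal \<open>min_card \<S>\<close> is
  the minimum of all \<open>|A|\<close> with \<open>A \<in> \<S>\<close>; it is meaningful for nonempty \<open>\<S>\<close> only.
\<close>

definition min_card :: "'a set set \<Rightarrow> 'a rel" where
  "min_card \<S> = card_of (SOME A. A \<in> \<S> \<and> (\<forall>B\<in>\<S>. |A| \<le>o |B| ))"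

lemma min_card_attained:
  assumes "\<S> \<noteq> {}"
  shows "\<exists>A\<in>\<S>. min_card \<S> = |A| \<and> (\<forall>B\<in>\<S>. |A| \<le>o |B| )"
proof -
  have "\<exists>r\<in>card_of ` \<S>. \<forall>r'\<in>card_of ` \<S>. r \<le>o r'"
    using assms by (intro exists_minim_Card_order) (auto simp: card_of_Card_order)
  then have "\<exists>A. A \<in> \<S> \<and> (\<forall>B\<in>\<S>. |A| \<le>o |B| )"
    by auto
  from someI_ex[OF this] show ?thesis
    unfolding min_card_def by blast
qed

text \<open>Binary minimum and maximum of cardinals living on possibly different types.\<close>

definition cmin :: "'a rel \<Rightarrow> 'b rel \<Rightarrow> ('a + 'b) rel" where
  "cmin r s = (if r \<le>o s then |Inl ` Field r| else |Inr ` Field s| )"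

definition cmax :: "'a rel \<Rightarrow> 'b rel \<Rightarrow> ('a + 'b) rel" where
  "cmax r s = (if r \<le>o s then |Inr ` Field s| else |Inl ` Field r| )"

lemma card_of_image_Field_ordIso:
  assumes "Card_order r" "inj f"
  shows "|f ` Field r| =o r"
proof -
  have "bij_betw f (Field r) (f ` Field r)"
    using assms(2) by (auto simp: bij_betw_def inj_on_def)
  then have "|Field r| =o |f ` Field r|"
    by (meson card_of_ordIso)
  then show ?thesis
    using assms(1) card_of_Field_ordIso ordIso_symmetric ordIso_transitive by blast
qed

lemma ordLeq_cmin_iff:
  assumes "Card_order r" "Card_order s"
  shows "t \<le>o cmin r s \<longleftrightarrow> t \<le>o r \<and> t \<le>o s"
proof -
  have l: "|Inl ` Field r| =o r" and r: "|Inr ` Field s| =o s"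
    using assms by (auto intro!: card_of_image_Field_ordIso)
  have tot: "r \<le>o s \<or> s \<le>o r"
    using assms by (meson card_order_on_well_order_on ordLeq_total)
  show ?thesis
    unfolding cmin_def using l r tot
    by (auto intro: ordLeq_transitive ordLeq_ordIso_trans ordIso_symmetric)
qed

lemma cmax_ordLeq_iff:
  assumes "Card_order r" "Card_order s"
  shows "cmax r s \<le>o t \<longleftrightarrow> r \<le>o t \<and> s \<le>o t"
proof -
  have l: "|Inl ` Field r| =o r" and r: "|Inr ` Field s| =o s"
    using assms by (auto intro!: card_of_image_Field_ordIso)
  have tot: "r \<le>o s \<or> s \<le>o r"
    using assms by (meson card_order_on_well_order_on ordLeq_total)
  have "|Inl ` Field r| \<le>o t \<longleftrightarrow> r \<le>o t" "|Inr ` Field s| \<le>o t \<longleftrightarrow> s \<le>o t"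
    using l r by (meson ordIso_ordLeq_trans ordIso_symmetric)+
  moreover have "s \<le>o t \<Longrightarrow> r \<le>o t" if "r \<le>o s"
    using that by (rule ordLeq_transitive)
  moreover have "r \<le>o t \<Longrightarrow> s \<le>o t" if "s \<le>o r"
    using that by (rule ordLeq_transitive)
  ultimately show ?thesis
    unfolding cmax_def using tot by auto
qed


section \<open>Cardinal invariants of a family of subsets of a type\<close>

definition add_card :: "'a set set \<Rightarrow> 'a set rel" where
  "add_card I = min_card {F. F \<subseteq> I \<and> \<Union>F \<notin> I}"

definition cov_card :: "'a set set \<Rightarrow> 'a set rel" where
  "cov_card I = min_card {F. F \<subseteq> I \<and> \<Union>F = UNIV}"

definition non_card :: "'a set set \<Rightarrow> 'a rel" where
  "non_card I = min_card {A. A \<notin> I}"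

definition cof_card :: "'a set set \<Rightarrow> 'a set rel" where
  "cof_card I = min_card {F. F \<subseteq> I \<and> (\<forall>A\<in>I. \<exists>B\<in>F. A \<subseteq> B)}"


section \<open>Splitting and reaping numbers\<close>

definition splits_set :: "nat set \<Rightarrow> nat set \<Rightarrow> bool" where
  "splits_set s a \<longleftrightarrow> infinite (a \<inter> s) \<and> infinite (a - s)"

definition splitting_number :: "nat set rel" where
  "splitting_number = min_card {S. S \<subseteq> {a. infinite a} \<and>
     (\<forall>a. infinite a \<longrightarrow> (\<exists>s\<in>S. splits_set s a))}"

definition reaping_number :: "nat set rel" where
  "reaping_number = min_card {R. R \<subseteq> {a. infinite a} \<and>
     \<not> (\<exists>s. \<forall>a\<in>R. splits_set s a)}"


section \<open>The null, meager and closed-null ideals on the Cantor space\<close>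

text \<open>The type \<open>nat \<Rightarrow> bool\<close> carries the product topology of the discrete space \<open>bool\<close>.\<close>

type_synonym cantor = "nat \<Rightarrow> bool"

definition cantor_measure :: "cantor measure" where
  "cantor_measure = (\<Pi>\<^sub>M n\<in>UNIV. measure_pmf (bernoulli_pmf (1/2)))"

definition null_ideal :: "cantor set set" where
  "null_ideal = null_sets (completion cantor_measure)"

definition meager_ideal :: "cantor set set" where
  "meager_ideal = {X. \<exists>F. countable F \<and> (\<forall>A\<in>F. interior (closure A) = {}) \<and> X = \<Union>F}"

definition sigma_ideal :: "'a set set \<Rightarrow> bool" where
  "sigma_ideal I \<longleftrightarrow> (\<forall>A B. A \<in> I \<and> B \<subseteq> A \<longrightarrow> B \<in> I) \<and>
     (\<forall>F. countable F \<and> F \<subseteq> I \<longrightarrow> \<Union>F \<in> I)"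

definition closed_null_ideal :: "cantor set set" where
  "closed_null_ideal = sigma_ideal hull {C. closed C \<and> C \<in> null_ideal}"


section \<open>Ideals on the natural numbers and the induced families\<close>

definition ideal_on_omega :: "nat set set \<Rightarrow> bool" where
  "ideal_on_omega J \<longleftrightarrow>
     (\<forall>a b. a \<in> J \<and> b \<subseteq> a \<longrightarrow> b \<in> J) \<and>
     (\<forall>a b. a \<in> J \<and> b \<in> J \<longrightarrow> a \<union> b \<in> J) \<and>
     (\<forall>a. finite a \<longrightarrow> a \<in> J) \<and>
     UNIV \<notin> J"

definition positive_sets :: "nat set set \<Rightarrow> nat set set" where
  "positive_sets J = UNIV - J"

definition dual_filter :: "nat set set \<Rightarrow> nat set set" where
  "dual_filter J = {UNIV - a | a. a \<in> J}"

definition clopen_sets :: "cantor set set" where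
  "clopen_sets = {C. open C \<and> closed C}"

definition N_inf :: "(nat \<Rightarrow> cantor set) \<Rightarrow> cantor set" where
  "N_inf c = {x. infinite {n. x \<in> c n}}"

definition Omega_bar :: "(nat \<Rightarrow> cantor set) set" where
  "Omega_bar = {c. (\<forall>n. c n \<in> clopen_sets) \<and> N_inf c \<in> null_sets cantor_measure}"

definition N_pos :: "nat set set \<Rightarrow> (nat \<Rightarrow> cantor set) \<Rightarrow> cantor set" where
  "N_pos J c = {x. {n. x \<in> c n} \<in> positive_sets J}"

definition N_dual :: "nat set set \<Rightarrow> (nat \<Rightarrow> cantor set) \<Rightarrow> cantor set" where
  "N_dual J c = {x. {n. x \<in> c n} \<in> dual_filter J}"

definition NJ :: "nat set set \<Rightarrow> cantor set set" where
  "NJ J = {X. \<exists>c\<in>Omega_bar. X \<subseteq> N_pos J c}"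

definition NJ_star :: "nat set set \<Rightarrow> cantor set set" where
  "NJ_star J = {X. \<exists>c\<in>Omega_bar. X \<subseteq> N_dual J c}"

end

theory Submission
  imports Defs
begin

text \<open>
  The inequalities involving \<open>J\<close> follow from
  \<open>\<E> \<subseteq> \<N>\<^sup>*\<^sub>J \<subseteq> \<N>\<^sub>J \<subseteq> \<N>\<close>. For the first inclusion,
  write a set in \<open>\<E>\<close> as an increasing union of closed null sets \<open>C\<^sub>n\<close>, cover \<open>C\<^sub>n\<close> by a clopen
  set of measure below \<open>2\<^sup>-\<^sup>n\<close>, and apply Borel--Cantelli.

  For the splitting and reaping numbers, the set of all \<open>x\<close> that do not split a fixed infinite
  \<open>a\<close> is in \<open>\<E>\<close>.

  For the meager ideal, fix disjoint blocks \<open>I\<^sub>m\<close> of size \<open>m\<close>. The set of all \<open>z\<close> that agree with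
  \<open>x\<close> on only finitely many blocks is meager; if a meager \<open>B\<close> contains it, then any \<open>z \<notin> B\<close>
  agrees with \<open>x\<close> on infinitely many blocks. Let \<open>f n\<close> be the first \<open>m \<ge> n\<close> such that \<open>x\<close> and \<open>z\<close>
  agree on \<open>I\<^sub>m\<close>. The set of all points having a \<open>1\<close> in almost every \<open>[n, f n]\<close> is meager, and any
  meager \<open>B'\<close> containing it yields an \<open>h\<close>, depending on \<open>B'\<close> only, that eventually dominates
  \<open>f\<close>. Hence \<open>x\<close> lies in the set of points which, for almost all \<open>n\<close>, agree with \<open>z\<close> on some
  \<open>I\<^sub>m\<close> with \<open>n \<le> m \<le> h n\<close>, and this set is in \<open>\<E>\<close>. As the second meager set depends on the
  choice of \<open>z\<close>, the argument for the cofinality uses pairs from a cofinal family.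
\<close>

section \<open>Minimal cardinals\<close>

lemma min_card_ordLeq:
  assumes "A \<in> \<S>"
  shows "min_card \<S> \<le>o |A|"
  using min_card_attained[of \<S>] assms by fastforce

lemma ordLeq_min_card:
  assumes "\<S> \<noteq> {}" "\<And>A. A \<in> \<S> \<Longrightarrow> r \<le>o |A|"
  shows "r \<le>o min_card \<S>"
  using min_card_attained[OF assms(1)] assms(2) by auto

lemma min_card_mono:
  assumes "\<T> \<noteq> {}" "\<T> \<subseteq> \<S>"
  shows "min_card \<S> \<le>o min_card \<T>"
  using assms by (intro ordLeq_min_card min_card_ordLeq) auto

lemma Card_order_min_card: "Card_order (min_card \<S>)"
  unfolding min_card_def by (rule card_of_Card_order)

text \<open>As \<open>min_card\<close> of an empty family is a meaningless value, the smaller family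
  \<open>I\<close> must come with a cover \<open>F\<close>. In \<open>non_card_mono\<close> the
  hypothesis on \<open>UNIV\<close> has the same purpose.\<close>

lemma cov_card_antimono:
  assumes "I \<subseteq> K" "F \<subseteq> I" "\<Union>F = UNIV"
  shows "cov_card K \<le>o cov_card I"
  unfolding cov_card_def using assms by (intro min_card_mono) auto

lemma non_card_mono:
  assumes "I \<subseteq> K" "UNIV \<notin> K"
  shows "non_card I \<le>o non_card K"
  unfolding non_card_def using assms by (intro min_card_mono) auto


section \<open>Topology and measure of the Cantor space\<close>

text \<open>A basic open box restricts finitely many coordinates, all below some \<open>n\<close>;
  conversely, the points sharing the first \<open>n\<close> bits of \<open>x\<close> form an open
  box. Topological arguments below thus reduce to finite prefixes.\<close>

lemma open_cantor_iff:
  fixes U :: "cantor set"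
  shows "open U \<longleftrightarrow> (\<forall>x\<in>U. \<exists>n. \<forall>y. (\<forall>i<n. y i = x i) \<longrightarrow> y \<in> U)"
proof
  assume "open U"
  show "\<forall>x\<in>U. \<exists>n. \<forall>y. (\<forall>i<n. y i = x i) \<longrightarrow> y \<in> U"
  proof
    fix x assume "x \<in> U"
    have "openin (product_topology (\<lambda>i::nat. euclidean :: bool topology) UNIV) U"
      using \<open>open U\<close> unfolding open_fun_def .
    from product_topology_open_contains_basis[OF this \<open>x \<in> U\<close>]
    obtain X where X: "x \<in> Pi\<^sub>E UNIV X" "finite {i. X i \<noteq> (UNIV :: bool set)}" "Pi\<^sub>E UNIV X \<subseteq> U"
      by (auto simp: PiE_def Pi_def)
    obtain n where n: "\<And>i. X i \<noteq> UNIV \<Longrightarrow> i < n"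
      using X(2) by (metis (mono_tags, lifting) finite_nat_set_iff_bounded mem_Collect_eq)
    have "y \<in> U" if "\<forall>i<n. y i = x i" for y
    proof -
      have "y i \<in> X i" for i
        using X(1) n[of i] that by (cases "X i = UNIV") (auto simp: PiE_def Pi_def)
      then show ?thesis using X(3) by (auto simp: PiE_def Pi_def)
    qed
    then show "\<exists>n. \<forall>y. (\<forall>i<n. y i = x i) \<longrightarrow> y \<in> U" by blast
  qed
next
  assume *: "\<forall>x\<in>U. \<exists>n. \<forall>y. (\<forall>i<n. y i = x i) \<longrightarrow> y \<in> U"
  show "open U"
  proof (subst open_subopen, intro ballI)
    fix x assume "x \<in> U"
    then obtain n where n: "\<And>y. (\<forall>i<n. y i = x i) \<Longrightarrow> y \<in> U" using * by blast
    define X where "X i = (if i < n then {x i} else UNIV)" for i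
    have "open (Pi\<^sub>E UNIV X)"
      by (rule open_PiE) (auto simp: X_def Topological_Spaces.open_discrete intro: finite_subset[of _ "{..<n}"])
    moreover have "x \<in> Pi\<^sub>E UNIV X" "Pi\<^sub>E UNIV X \<subseteq> U"
      using n by (auto simp: X_def PiE_def Pi_def split: if_splits)
    ultimately show "\<exists>T. open T \<and> x \<in> T \<and> T \<subseteq> U" by blast
  qed
qed

lemma closed_cantor_iff:
  fixes C :: "cantor set"
  shows "closed C \<longleftrightarrow> (\<forall>x. x \<notin> C \<longrightarrow> (\<exists>n. \<forall>y. (\<forall>i<n. y i = x i) \<longrightarrow> y \<notin> C))"
  unfolding closed_def open_cantor_iff by (simp add: Ball_def)

lemma clopen_cantorI:
  fixes C :: "cantor set"
  assumes "\<And>x y. (\<forall>i<n. y i = x i) \<Longrightarrow> x \<in> C \<longleftrightarrow> y \<in> C"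
  shows "C \<in> clopen_sets"
  unfolding clopen_sets_def open_cantor_iff closed_cantor_iff using assms by blast

lemma closed_finite_cantor:
  fixes Z :: "cantor set"
  assumes "finite Z"
  shows "closed Z"
proof -
  have "closed {z}" for z :: cantor
    unfolding closed_cantor_iff
  proof (intro allI impI)
    fix x assume "x \<notin> {z}"
    then obtain i where "x i \<noteq> z i" by auto
    then show "\<exists>n. \<forall>y. (\<forall>i<n. y i = x i) \<longrightarrow> y \<notin> {z}" by (intro exI[of _ "Suc i"]) auto
  qed
  then have "closed (\<Union>z\<in>Z. {z})" using assms by (intro closed_UN) auto
  then show ?thesis by simp
qed

lemma nowhere_dense_cantorI:
  fixes A :: "cantor set"
  assumes "closed A" "\<And>w n. \<exists>x. (\<forall>i<n. x i = w i) \<and> x \<notin> A"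
  shows "interior (closure A) = {}"
proof -
  have "x \<notin> interior A" for x
  proof
    assume "x \<in> interior A"
    then obtain n where "\<And>y. \<forall>i<n. y i = x i \<Longrightarrow> y \<in> interior A"
      using open_interior[of A] unfolding open_cantor_iff by blast
    moreover obtain y where "\<forall>i<n. y i = x i" "y \<notin> A" using assms(2) by blast
    ultimately show False using interior_subset by blast
  qed
  then show ?thesis using assms(1) by auto
qed

text \<open>Second countability of the factors makes the product sigma-algebra coincide with the
  Borel one, via \<open>sets_PiM_equal_borel\<close>.\<close>

instance bool :: second_countable_topology
  by standard (auto simp: open_bool_def intro!: exI)

lemma sets_cantor_measure: "sets cantor_measure = sets (borel :: cantor measure)"
proof -
  have "sets cantor_measure = sets (\<Pi>\<^sub>M n\<in>(UNIV :: nat set). (borel :: bool measure))"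
    unfolding cantor_measure_def
    by (rule sets_PiM_cong) (auto simp: sets_borel_eq_count_space)
  then show ?thesis by (simp add: sets_PiM_equal_borel)
qed

lemma space_cantor_measure: "space cantor_measure = UNIV"
  using sets_eq_imp_space_eq[OF sets_cantor_measure] by simp

lemma prob_space_cantor_measure: "prob_space cantor_measure"
  unfolding cantor_measure_def by (intro prob_space_PiM prob_space_measure_pmf)

lemma clopen_measurable: "C \<in> clopen_sets \<Longrightarrow> C \<in> sets cantor_measure"
  by (auto simp: clopen_sets_def sets_cantor_measure)

text \<open>Every explicit measure estimate below comes from this one: prescribing finitely many
  bits is a finite-dimensional box with factors \<open>1/2\<close>.\<close>

lemma measure_cantor_agree:
  assumes "finite K"
  shows "measure cantor_measure {x. \<forall>i\<in>K. x i = z i} = (1/2) ^ card K"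
proof -
  interpret product_prob_space "\<lambda>_::nat. measure_pmf (bernoulli_pmf (1/2))" UNIV
    by unfold_locales
  let ?M = "\<lambda>_::nat. measure_pmf (bernoulli_pmf (1/2))"
  have half: "measure (?M i) {z i} = 1/2" for i
    by (cases "z i") (simp_all add: measure_pmf_single)
  have emb: "{x. \<forall>i\<in>K. x i = z i} = prod_emb UNIV ?M K (Pi\<^sub>E K (\<lambda>i. {z i}))"
  proof (rule set_eqI)
    fix x
    show "x \<in> {x. \<forall>i\<in>K. x i = z i} \<longleftrightarrow> x \<in> prod_emb UNIV ?M K (Pi\<^sub>E K (\<lambda>i. {z i}))"
      by (simp add: prod_emb_iff PiE_iff)
  qed
  show ?thesis
    unfolding cantor_measure_def emb using assms by (subst measure_PiM_emb) (simp_all add: half)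
qed

lemma null_setsI_measure_less:
  assumes "A \<in> sets cantor_measure" "\<And>e. e > 0 \<Longrightarrow> measure cantor_measure A < e"
  shows "A \<in> null_sets cantor_measure"
proof -
  interpret prob_space cantor_measure by (rule prob_space_cantor_measure)
  have "measure cantor_measure A = 0"
    using assms(2)[of "measure cantor_measure A"] measure_nonneg[of cantor_measure A]
    by (cases "measure cantor_measure A = 0") auto
  then show ?thesis using assms(1) by (auto simp: null_sets_def emeasure_eq_measure)
qed

lemma null_ideal_subset: "A \<in> null_ideal \<Longrightarrow> B \<subseteq> A \<Longrightarrow> B \<in> null_ideal"
  unfolding null_ideal_def by (rule null_sets_completion_subset)

lemma UNIV_not_null: "UNIV \<notin> null_ideal"
proof -
  have "UNIV \<in> sets cantor_measure" by (simp add: sets_cantor_measure)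
  moreover have "emeasure cantor_measure UNIV = 1"
    using prob_space.emeasure_space_1[OF prob_space_cantor_measure] by (simp add: space_cantor_measure)
  ultimately show ?thesis
    unfolding null_ideal_def by (subst null_sets_completion_iff) (auto simp: null_sets_def)
qed

lemma closed_null_iff:
  assumes "closed C"
  shows "C \<in> null_ideal \<longleftrightarrow> C \<in> null_sets cantor_measure"
  unfolding null_ideal_def using assms
  by (intro null_sets_completion_iff) (simp add: sets_cantor_measure)


section \<open>The ideal generated by closed null sets\<close>

text \<open>The sets on the right form a sigma-ideal containing the generators, so the hull lies
  among them. Conversely, an intersection of sigma-ideals is a sigma-ideal, so the hull is itself
  one and contains every such set.\<close>

lemma closed_null_ideal_iff:
  "X \<in> closed_null_ideal \<longleftrightarrow>
    (\<exists>F. countable F \<and> F \<subseteq> {C. closed C \<and> C \<in> null_ideal} \<and> X \<subseteq> \<Union>F)" (is "_ \<longleftrightarrow> ?E X")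
proof
  let ?S = "{C. closed C \<and> C \<in> null_ideal}"
  have "sigma_ideal {X. ?E X}"
    unfolding sigma_ideal_def
  proof (intro conjI allI impI)
    fix A B assume AB: "A \<in> {X. ?E X} \<and> B \<subseteq> A"
    then have "?E A" by simp
    then obtain F where F: "countable F" "F \<subseteq> ?S" "A \<subseteq> \<Union>F" by (elim exE conjE)
    then have "B \<subseteq> \<Union>F" using AB by (meson subset_trans)
    with F(1,2) have "?E B" by (intro exI[of _ F] conjI)
    then show "B \<in> {X. ?E X}" by simp
  next
    fix G assume G: "countable G \<and> G \<subseteq> {X. ?E X}"
    then have "\<forall>A\<in>G. ?E A" by (simp add: subset_iff)
    from bchoice[OF this] obtain H
      where H: "\<forall>A\<in>G. countable (H A) \<and> H A \<subseteq> ?S \<and> A \<subseteq> \<Union>(H A)"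
      by (elim exE)
    have "countable (\<Union>A\<in>G. H A)" using G H by (intro countable_UN) auto
    moreover have "(\<Union>A\<in>G. H A) \<subseteq> ?S" using H by blast
    moreover have "\<Union>G \<subseteq> \<Union>(\<Union>A\<in>G. H A)" using H by blast
    ultimately have "?E (\<Union>G)" by (intro exI[of _ "\<Union>A\<in>G. H A"] conjI)
    then show "\<Union>G \<in> {X. ?E X}" by simp
  qed
  moreover have "C \<in> {X. ?E X}" if "C \<in> ?S" for C
    using that by (intro CollectI exI[of _ "{C}"]) auto
  ultimately have "closed_null_ideal \<subseteq> {X. ?E X}"
    unfolding closed_null_ideal_def by (intro hull_minimal) auto
  then show "X \<in> closed_null_ideal \<Longrightarrow> ?E X" by (auto simp only: subset_iff mem_Collect_eq)
next
  assume "?E X"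
  have "sigma_ideal (\<Inter>T)" if "Ball T sigma_ideal" for T :: "cantor set set set"
    unfolding sigma_ideal_def
  proof (intro conjI allI impI InterI)
    fix I A B assume "I \<in> T" "A \<in> \<Inter>T \<and> B \<subseteq> A"
    then show "B \<in> I" using that unfolding sigma_ideal_def by (meson InterE)
  next
    fix I F assume "I \<in> T" "countable F \<and> F \<subseteq> \<Inter>T"
    moreover from this have "F \<subseteq> I" by blast
    ultimately show "\<Union>F \<in> I" using that unfolding sigma_ideal_def by meson
  qed
  then have "sigma_ideal closed_null_ideal"
    unfolding closed_null_ideal_def by (rule hull_in)
  moreover have "{C. closed C \<and> C \<in> null_ideal} \<subseteq> closed_null_ideal"
    unfolding closed_null_ideal_def by (rule hull_subset)
  ultimately show "X \<in> closed_null_ideal"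
    using \<open>?E X\<close> unfolding sigma_ideal_def by (meson subset_trans)
qed

lemma closed_null_ideal_subset:
  assumes "A \<in> closed_null_ideal" "B \<subseteq> A"
  shows "B \<in> closed_null_ideal"
  using assms unfolding closed_null_ideal_iff by (meson subset_trans)

lemma closed_null_idealI:
  assumes "\<And>k::nat. closed (C k)" "\<And>k. C k \<in> null_sets cantor_measure" "X \<subseteq> (\<Union>k. C k)"
  shows "X \<in> closed_null_ideal"
  unfolding closed_null_ideal_iff using assms
  by (intro exI[of _ "range C"]) (auto simp: closed_null_iff)

lemma closed_null_ideal_sequence:
  assumes "X \<in> closed_null_ideal"
  obtains C :: "nat \<Rightarrow> cantor set"
  where "\<And>k. closed (C k)" "\<And>k. C k \<in> null_sets cantor_measure" "X \<subseteq> (\<Union>k. C k)"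
proof -
  obtain F where F: "countable F" "F \<subseteq> {C. closed C \<and> C \<in> null_ideal}" "X \<subseteq> \<Union>F"
    using assms unfolding closed_null_ideal_iff by blast
  \<comment> \<open>Inserting the empty set makes the family nonempty, as an enumeration by all of
    \<open>nat\<close> requires.\<close>
  define C where "C = from_nat_into (insert {} F)"
  have "C k \<in> insert {} F" for k
    unfolding C_def by (rule from_nat_into) simp
  moreover have "range C = insert {} F"
    unfolding C_def using F(1) by (intro range_from_nat_into) auto
  moreover have "closed A \<and> A \<in> null_sets cantor_measure" if "A \<in> insert {} F" for A
    using that F(2) closed_null_iff by blast
  ultimately show ?thesis
    using F(3) by (intro that[of C]) auto
qed

text \<open>Prefixes of length \<open>n\<close> shrink the measure to \<open>(1/2) ^ n\<close>. The
  singletons provide a cover by members of the ideal, so its covering number is meaningful.\<close>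

lemma singleton_closed_null: "{x} \<in> closed_null_ideal"
proof (rule closed_null_idealI[of "\<lambda>_. {x}"])
  interpret prob_space cantor_measure by (rule prob_space_cantor_measure)
  have "{x} \<in> sets cantor_measure" by (simp add: sets_cantor_measure closed_finite_cantor)
  moreover have "measure cantor_measure {x} < e" if "e > 0" for e
  proof -
    obtain n where n: "(1/2::real) ^ n < e" using \<open>e > 0\<close> real_arch_pow_inv[of e "1/2"] by auto
    have "measure cantor_measure {x} \<le> measure cantor_measure {y. \<forall>i\<in>{..<n}. y i = x i}"
      by (intro finite_measure_mono clopen_measurable clopen_cantorI[of n]) auto
    then show ?thesis using n measure_cantor_agree[of "{..<n}" x] by simp
  qed
  ultimately show "{x} \<in> null_sets cantor_measure" by (rule null_setsI_measure_less)
qed (auto simp: closed_finite_cantor)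

text \<open>The prefix neighbourhoods \<open>U n\<close> of \<open>C\<close> are clopen and decrease
  to \<open>C\<close> because \<open>C\<close> is closed; continuity of the measure from above makes
  some \<open>U n\<close> small.\<close>

lemma closed_null_clopen_cover:
  assumes "closed C" "C \<in> null_sets cantor_measure" "e > 0"
  shows "\<exists>U\<in>clopen_sets. C \<subseteq> U \<and> measure cantor_measure U < e"
proof -
  interpret prob_space cantor_measure by (rule prob_space_cantor_measure)
  define U where "U n = {x. \<exists>y\<in>C. \<forall>i<n. y i = x i}" for n :: nat
  have clopen: "U n \<in> clopen_sets" for n
    by (rule clopen_cantorI[of n]) (simp add: U_def)
  have "(\<Inter>n. U n) = C"
  proof
    show "(\<Inter>n. U n) \<subseteq> C"
    proof
      fix x assume x: "x \<in> (\<Inter>n. U n)"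
      show "x \<in> C"
      proof (rule ccontr)
        assume "x \<notin> C"
        then obtain n where "\<And>y. (\<forall>i<n. y i = x i) \<Longrightarrow> y \<notin> C"
          using assms(1) unfolding closed_cantor_iff by blast
        moreover have "x \<in> U n" using x by blast
        ultimately show False unfolding U_def by blast
      qed
    qed
  qed (auto simp: U_def)
  moreover have "(\<lambda>n. measure cantor_measure (U n)) \<longlonglongrightarrow> measure cantor_measure (\<Inter>n. U n)"
  proof (rule finite_Lim_measure_decseq)
    show "range U \<subseteq> sets cantor_measure" using clopen clopen_measurable by blast
    show "decseq U"
    proof (rule decseq_SucI, rule subsetI)
      fix n x assume "x \<in> U (Suc n)"
      then obtain y where "y \<in> C" "\<forall>i<Suc n. y i = x i" unfolding U_def by blast
      then show "x \<in> U n" unfolding U_def by (intro CollectI bexI[of _ y]) auto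
    qed
  qed
  moreover have "measure cantor_measure C = 0"
    using assms(2) by (simp add: measure_def null_sets_def)
  ultimately have "(\<lambda>n. measure cantor_measure (U n)) \<longlonglongrightarrow> 0" by simp
  then obtain n where "measure cantor_measure (U n) < e"
    using order_tendstoD(2)[OF _ assms(3)] by (metis eventually_sequentially order_refl)
  moreover have "C \<subseteq> U n" by (auto simp: U_def)
  ultimately show ?thesis using clopen by blast
qed


section \<open>Inclusions between the families\<close>

text \<open>Finite sets belong to \<open>J\<close>, so positive sets are infinite and
  \<open>N_pos J c\<close> lies inside the null set \<open>N_inf c\<close>.\<close>

lemma NJ_subset_null_ideal:
  assumes "ideal_on_omega J"
  shows "NJ J \<subseteq> null_ideal"
proof
  fix X assume "X \<in> NJ J"
  then obtain c where c: "c \<in> Omega_bar" "X \<subseteq> N_pos J c" unfolding NJ_def by blast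
  have "N_pos J c \<subseteq> N_inf c"
    using assms unfolding N_pos_def N_inf_def positive_sets_def ideal_on_omega_def by blast
  moreover have "N_inf c \<in> null_ideal"
    using c(1) by (auto simp: Omega_bar_def null_ideal_def intro: null_sets_completionI)
  ultimately show "X \<in> null_ideal" using c(2) null_ideal_subset by blast
qed

text \<open>If \<open>J\<close> contained both a set and its complement, it would contain
  \<open>UNIV\<close>; so the dual filter consists of positive sets.\<close>

lemma NJ_star_subset_NJ:
  assumes "ideal_on_omega J"
  shows "NJ_star J \<subseteq> NJ J"
proof -
  have "UNIV - a \<in> positive_sets J" if "a \<in> J" for a
  proof -
    have "a \<union> (UNIV - a) = UNIV" by blast
    then show ?thesis
      using assms that unfolding ideal_on_omega_def positive_sets_def by (metis Diff_iff UNIV_I)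
  qed
  then have "N_dual J c \<subseteq> N_pos J c" for c
    unfolding N_dual_def N_pos_def dual_filter_def by auto
  then show ?thesis unfolding NJ_star_def NJ_def by blast
qed

lemma closed_null_ideal_subset_NJ_star:
  assumes "ideal_on_omega J"
  shows "closed_null_ideal \<subseteq> NJ_star J"
proof
  interpret prob_space cantor_measure by (rule prob_space_cantor_measure)
  fix X assume "X \<in> closed_null_ideal"
  then obtain C where C: "\<And>k::nat. closed (C k)" "\<And>k. C k \<in> null_sets cantor_measure"
    "X \<subseteq> (\<Union>k. C k)" using closed_null_ideal_sequence by blast
  \<comment> \<open>Covering the union of all \<open>C k\<close> with \<open>k\<close> up to
    \<open>n\<close> puts a point of \<open>C k\<close> into every \<open>c n\<close> from
    \<open>k\<close> on. The exceptional indices are then finite in number, hence form a set in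
    \<open>J\<close>, and the measures are summable.\<close>
  have "\<exists>U\<in>clopen_sets. (\<Union>k\<le>n. C k) \<subseteq> U \<and> measure cantor_measure U < (1/2) ^ n" for n
    using C by (intro closed_null_clopen_cover) (auto intro!: closed_UN null_sets_UN')
  then obtain c where c: "\<And>n. c n \<in> clopen_sets" "\<And>n. (\<Union>k\<le>n. C k) \<subseteq> c n"
    "\<And>n. measure cantor_measure (c n) < (1/2) ^ n" by metis
  have "limsup c \<in> null_sets cantor_measure"
  proof (rule borel_cantelli_limsup1)
    show "summable (\<lambda>n. measure cantor_measure (c n))"
    proof (rule summable_comparison_test')
      show "summable (\<lambda>n. (1/2::real) ^ n)" by simp
      show "norm (measure cantor_measure (c n)) \<le> (1/2) ^ n" for n
        using c(3)[of n] by simp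
    qed
    show "emeasure cantor_measure (c n) < \<infinity>" for n
      by (simp add: emeasure_eq_measure)
  qed (rule clopen_measurable[OF c(1)])
  moreover have "limsup c = N_inf c"
    by (auto simp: N_inf_def limsup_INF_SUP infinite_nat_iff_unbounded_le)
  ultimately have "c \<in> Omega_bar" using c(1) by (simp add: Omega_bar_def)
  moreover have "X \<subseteq> N_dual J c"
  proof
    fix x assume "x \<in> X"
    then obtain k where "x \<in> C k" using C(3) by blast
    then have "UNIV - {n. x \<in> c n} \<subseteq> {..<k}"
      using c(2) by (fastforce simp: not_less[symmetric])
    then have "UNIV - {n. x \<in> c n} \<in> J"
      using assms finite_subset unfolding ideal_on_omega_def by blast
    moreover have "{n. x \<in> c n} = UNIV - (UNIV - {n. x \<in> c n})" by blast
    ultimately show "x \<in> N_dual J c" unfolding N_dual_def dual_filter_def by blast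
  qed
  ultimately show "X \<in> NJ_star J" unfolding NJ_star_def by blast
qed


section \<open>Splitting and reaping\<close>

text \<open>A point fails to split \<open>a\<close> exactly when it is eventually constant on
  \<open>a\<close>. Being constant on \<open>a\<close> from \<open>k\<close> on is a closed
  condition that fixes arbitrarily many bits, hence a null one.\<close>

lemma not_split_closed_null:
  assumes "infinite a"
  shows "{x. \<not> splits_set {n. x n} a} \<in> closed_null_ideal"
proof -
  interpret prob_space cantor_measure by (rule prob_space_cantor_measure)
  define D where "D b k = {x::cantor. \<forall>i\<in>a. k \<le> i \<longrightarrow> x i = b}" for b and k :: nat
  have closed: "closed (D b k)" for b k
    unfolding closed_cantor_iff
  proof (intro allI impI)
    fix x assume "x \<notin> D b k"
    then obtain i where "i \<in> a" "k \<le> i" "x i \<noteq> b" unfolding D_def by blast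
    then show "\<exists>n. \<forall>y. (\<forall>i<n. y i = x i) \<longrightarrow> y \<notin> D b k"
      unfolding D_def by (intro exI[of _ "Suc i"]) auto
  qed
  have null: "D b k \<in> null_sets cantor_measure" for b k
  proof (rule null_setsI_measure_less)
    show "D b k \<in> sets cantor_measure" using closed by (simp add: sets_cantor_measure)
    fix e :: real assume "e > 0"
    then obtain n where n: "(1/2::real) ^ n < e" using real_arch_pow_inv[of e "1/2"] by auto
    have "infinite (a - {..<k})" using assms by simp
    then obtain K where K: "finite K" "card K = n" "K \<subseteq> a - {..<k}"
      by (meson infinite_arbitrarily_large)
    obtain N where N: "K \<subseteq> {..<N}" using K(1) finite_nat_iff_bounded by blast
    have "measure cantor_measure (D b k) \<le> measure cantor_measure {x. \<forall>i\<in>K. x i = b}"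
      using K(3) N by (intro finite_measure_mono clopen_measurable clopen_cantorI[of N])
        (auto simp: D_def subset_iff not_less)
    then show "measure cantor_measure (D b k) < e"
      using n K measure_cantor_agree[of K "\<lambda>_. b"] by simp
  qed
  have cover: "\<exists>k. x \<in> D True k \<union> D False k" if "\<not> splits_set {n. x n} a" for x
  proof -
    have "\<exists>k. \<forall>i\<in>a. k \<le> i \<longrightarrow> x i = b" if "finite (a \<inter> {i. x i \<noteq> b})" for b
    proof -
      obtain k where "a \<inter> {i. x i \<noteq> b} \<subseteq> {..<k}" using \<open>finite _\<close> finite_nat_iff_bounded by blast
      then show ?thesis by (intro exI[of _ k]) auto
    qed
    from this[of True] this[of False] that show ?thesis
      unfolding splits_set_def D_def by (auto simp: Int_def set_diff_eq)
  qed
  show ?thesis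
  proof (rule closed_null_idealI[of "\<lambda>k. D True k \<union> D False k"])
    show "closed (D True k \<union> D False k)" "D True k \<union> D False k \<in> null_sets cantor_measure" for k
      using closed null by auto
  qed (use cover in blast)
qed

text \<open>No single set splits all members of a reaping family \<open>R\<close>, so the sets of
  points not splitting \<open>a\<close>, for \<open>a\<close> in \<open>R\<close>, cover the
  space.\<close>

lemma cov_closed_null_le_reaping: "cov_card closed_null_ideal \<le>o reaping_number"
  unfolding reaping_number_def
proof (rule ordLeq_min_card)
  \<comment> \<open>The infinite sets form a reaping family: a finite \<open>s\<close> does not
    split \<open>UNIV\<close>, and an infinite \<open>s\<close> does not split itself.\<close>
  have "\<exists>a. infinite a \<and> \<not> splits_set s a" for s
  proof (cases "finite s")
    case True
    then show ?thesis unfolding splits_set_def by (metis finite_Int infinite_UNIV_nat)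
  next
    case False
    then show ?thesis unfolding splits_set_def by (metis Diff_cancel finite.emptyI)
  qed
  then have "\<not> (\<exists>s. \<forall>a\<in>{a. infinite a}. splits_set s a)" by simp
  then show "{R. R \<subseteq> {a. infinite a} \<and> \<not> (\<exists>s. \<forall>a\<in>R. splits_set s a)} \<noteq> {}" by blast
next
  fix R assume R: "R \<in> {R. R \<subseteq> {a. infinite a} \<and> \<not> (\<exists>s. \<forall>a\<in>R. splits_set s a)}"
  define F where "F = (\<lambda>a. {x. \<not> splits_set {n. x n} a}) ` R"
  have "F \<subseteq> closed_null_ideal" using R not_split_closed_null by (auto simp: F_def)
  moreover have "\<Union>F = UNIV" using R by (auto simp: F_def)
  ultimately have "cov_card closed_null_ideal \<le>o |F|"
    unfolding cov_card_def by (intro min_card_ordLeq) auto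
  also have "|F| \<le>o |R|" unfolding F_def by (rule card_of_image)
  finally show "cov_card closed_null_ideal \<le>o |R|" .
qed

lemma splitting_le_card_not_closed_null:
  assumes "X \<notin> closed_null_ideal"
  shows "splitting_number \<le>o |X|"
proof -
  \<comment> \<open>Finite sets are dropped since a splitting family consists of infinite sets; a
    set that splits something is infinite anyway.\<close>
  define S where "S = {s \<in> (\<lambda>x. {n. x n}) ` X. infinite s}"
  have "\<exists>s\<in>S. splits_set s a" if "infinite a" for a
  proof -
    have "\<not> X \<subseteq> {x. \<not> splits_set {n. x n} a}"
      using assms closed_null_ideal_subset[OF not_split_closed_null[OF that]] by blast
    then obtain x where "x \<in> X" "splits_set {n. x n} a" by blast
    moreover from this(2) have "infinite {n. x n}" by (auto simp: splits_set_def)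
    ultimately show ?thesis by (auto simp: S_def)
  qed
  then have "splitting_number \<le>o |S|"
    unfolding splitting_number_def by (intro min_card_ordLeq) (auto simp: S_def)
  also have "|S| \<le>o |X|"
    unfolding S_def by (rule surj_imp_ordLeq[of _ "\<lambda>x. {n. x n}"]) blast
  finally show ?thesis .
qed


section \<open>Meager sets\<close>

lemma meager_idealI:
  assumes "\<And>k::nat. closed (A k)" "\<And>k w n. \<exists>x. (\<forall>i<n. x i = w i) \<and> x \<notin> A k"
  shows "(\<Union>k. A k) \<in> meager_ideal"
  unfolding meager_ideal_def using nowhere_dense_cantorI[OF assms]
  by (intro CollectI exI[of _ "range A"]) auto

text \<open>Each prefix has infinitely many extensions \<open>u k\<close>, so a finite set misses
  one. This serves to show that cofinal families of meager sets are infinite.\<close>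

lemma finite_meager:
  assumes "finite Z"
  shows "Z \<in> meager_ideal"
proof -
  have "\<exists>x. (\<forall>i<n. x i = w i) \<and> x \<notin> Z" for n and w :: cantor
  proof -
    define u where "u k = (\<lambda>i. if i < n then w i else i = n + k)" for k
    have "u k (n + k)" "k \<noteq> l \<Longrightarrow> \<not> u l (n + k)" for k l by (auto simp: u_def)
    then have "inj u" unfolding inj_def by metis
    then have "infinite (range u)" using finite_imageD infinite_UNIV_nat by blast
    then have "\<not> range u \<subseteq> Z" using assms finite_subset by blast
    then obtain k where "u k \<notin> Z" by blast
    then show ?thesis by (intro exI[of _ "u k"]) (auto simp: u_def)
  qed
  then have "(\<Union>k::nat. Z) \<in> meager_ideal"
    using assms by (intro meager_idealI closed_finite_cantor) auto
  then show ?thesis by simp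
qed

text \<open>There are finitely many patterns below \<open>N\<close>. Treating them one after
  another, \<open>t\<close> is lengthened until each pattern followed by \<open>t\<close> is forced
  out of \<open>D\<close>; lengthening preserves what was achieved for earlier patterns.\<close>

lemma nowhere_dense_avoiding_block:
  fixes D :: "cantor set"
  assumes "closed D" "interior D = {}"
  shows "\<exists>m t. m > N \<and> t (m - 1) \<and> (\<forall>x. (\<forall>i\<in>{N..<m}. x i = t i) \<longrightarrow> x \<notin> D)"
proof -
  define S where "S = (\<lambda>A i. i \<in> A) ` Pow {..<N}"
  have *: "\<exists>m>N. \<exists>t. \<forall>s\<in>T. \<forall>x. (\<forall>i<N. x i = s i) \<and> (\<forall>i\<in>{N..<m}. x i = t i) \<longrightarrow> x \<notin> D"
    if "finite T" for T
    using that
  proof (induction T)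
    case empty
    show ?case by (intro exI[of _ "Suc N"]) simp
  next
    case (insert s T)
    from insert.IH obtain m t where m: "m > N"
      "\<forall>s\<in>T. \<forall>x. (\<forall>i<N. x i = s i) \<and> (\<forall>i\<in>{N..<m}. x i = t i) \<longrightarrow> x \<notin> D"
      by (elim exE conjE)
    \<comment> \<open>The cylinder of \<open>w\<close> is not contained in \<open>D\<close>, whose
      interior is empty; a point \<open>u\<close> of it outside the closed set \<open>D\<close>
      supplies the longer block.\<close>
    define w where "w i = (if i < N then s i else t i)" for i
    have "open {x. \<forall>i<m. x i = w i}"
      using clopen_cantorI[of m "{x. \<forall>i<m. x i = w i}"] by (auto simp: clopen_sets_def)
    moreover have "w \<in> {x. \<forall>i<m. x i = w i}" by simp
    ultimately obtain u where u: "\<And>i. i < m \<Longrightarrow> u i = w i" "u \<notin> D"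
      using interior_maximal[of "{x. \<forall>i<m. x i = w i}" D] assms(2) by blast
    obtain n where n: "\<And>x. \<forall>i<n. x i = u i \<Longrightarrow> x \<notin> D"
      using assms(1) u(2) unfolding closed_cantor_iff by blast
    have *: "x \<notin> D" if "s' \<in> insert s T" "\<forall>i<N. x i = s' i" "\<forall>i\<in>{N..<max m n}. x i = u i" for s' x
    proof (cases "s' = s")
      case True
      have "x i = u i" if "i < n" for i
        using u(1)[of i] \<open>\<forall>i<N. x i = s' i\<close> \<open>\<forall>i\<in>{N..<max m n}. x i = u i\<close> that True m(1)
        by (cases "i < N") (auto simp: w_def)
      then show ?thesis using n by blast
    next
      case False
      have "x i = t i" if "i \<in> {N..<m}" for i
        using u(1)[of i] \<open>\<forall>i\<in>{N..<max m n}. x i = u i\<close> that by (auto simp: w_def)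
      then show ?thesis using m(2) that False by simp
    qed
    show ?case
      by (intro exI[of _ "max m n"] exI[of _ u] conjI ballI allI impI) (use m(1) * in auto)
  qed
  have "finite S" unfolding S_def by simp
  from *[OF this] obtain m t where m: "m > N"
    "\<forall>s\<in>S. \<forall>x. (\<forall>i<N. x i = s i) \<and> (\<forall>i\<in>{N..<m}. x i = t i) \<longrightarrow> x \<notin> D"
    by (elim exE conjE)
  \<comment> \<open>Avoidance is already forced by the bits below \<open>m\<close>, so bit
    \<open>m\<close> is free and is set to \<open>True\<close> as the last bit of the block.\<close>
  have "x \<notin> D" if "\<forall>i\<in>{N..<Suc m}. x i = (t(m := True)) i" for x
  proof (rule m(2)[rule_format])
    show "(\<lambda>i. i \<in> {i\<in>{..<N}. x i}) \<in> S" unfolding S_def by blast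
  qed (use that m(1) in auto)
  then show ?thesis
    using m(1) by (intro exI[of _ "Suc m"] exI[of _ "t(m := True)"] conjI) auto
qed

text \<open>That every block ends in \<open>True\<close> keeps points matching \<open>y\<close> on many blocks
  from having long gaps.\<close>

lemma meager_avoiding_partition:
  assumes "B \<in> meager_ideal"
  obtains j :: "nat \<Rightarrow> nat" and y :: cantor
  where "strict_mono j" "\<And>k. y (j (Suc k) - 1)"
    "\<And>x. infinite {k. \<forall>i\<in>{j k..<j (Suc k)}. x i = y i} \<Longrightarrow> x \<notin> B"
proof -
  obtain F where F: "countable F" "\<And>A. A \<in> F \<Longrightarrow> interior (closure A) = {}" "B = \<Union>F"
    using assms unfolding meager_ideal_def by blast
  define A where "A = from_nat_into (insert {} F)"
  have A_in: "A k \<in> insert {} F" for k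
    unfolding A_def by (rule from_nat_into) simp
  have rangeA: "range A = insert {} F"
    unfolding A_def using F(1) by (intro range_from_nat_into) auto
  define D where "D n = (\<Union>i\<le>n. closure (A i))" for n :: nat
  have closed: "closed (D n)" for n unfolding D_def by (intro closed_UN) auto
  have empty: "interior (D n) = {}" for n
  proof (induction n)
    case 0
    then show ?case using A_in[of 0] F(2) by (auto simp: D_def)
  next
    case (Suc n)
    have "interior (closure (A (Suc n))) = {}" using A_in[of "Suc n"] F(2) by auto
    then have "interior (D n \<union> closure (A (Suc n))) = {}"
      using Suc interior_closed_Un_empty_interior[OF closed] by simp
    then show ?case by (simp add: D_def atMost_Suc Un_commute)
  qed
  define P where "P N n m t \<longleftrightarrow> m > N \<and> t (m - 1) \<and>
    (\<forall>x. (\<forall>i\<in>{N..<m}. x i = t i) \<longrightarrow> x \<notin> D n)" for N n m t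
  have "\<exists>m t. P N n m t" for N n
    unfolding P_def by (rule nowhere_dense_avoiding_block[OF closed empty])
  then obtain m t where "\<And>N n. P N n (m N n) (t N n)"
    by metis
  then have mt: "\<And>N n. m N n > N" "\<And>N n. t N n (m N n - 1)"
    "\<And>N n x. \<forall>i\<in>{N..<m N n}. x i = t N n i \<Longrightarrow> x \<notin> D n"
    unfolding P_def by simp_all
  \<comment> \<open>The \<open>k\<close>-th interval is chosen to avoid \<open>D k\<close>. As the
    sets \<open>D k\<close> increase, a match with \<open>y\<close> on a late enough interval
    excludes membership in any given \<open>A n\<close>.\<close>
  define j where "j = rec_nat 0 (\<lambda>k N. m N k)"
  have j_Suc: "j (Suc k) = m (j k) k" for k by (simp add: j_def)
  have mono: "strict_mono j" by (simp add: strict_mono_Suc_iff j_Suc mt(1))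
  define b where "b i = (LEAST k. i < j (Suc k))" for i
  have b: "b i = k" if "i \<in> {j k..<j (Suc k)}" for i k
    unfolding b_def
  proof (rule Least_equality)
    fix l assume "i < j (Suc l)"
    then have "j k < j (Suc l)" using that by simp
    then show "k \<le> l" using mono by (simp add: strict_mono_less)
  qed (use that in simp)
  define y where "y i = t (j (b i)) (b i) i" for i
  have y: "y i = t (j k) k i" if "i \<in> {j k..<j (Suc k)}" for i k
    unfolding y_def b[OF that] ..
  show ?thesis
  proof (rule that[OF mono])
    fix k
    have "j k < j (Suc k)" using mono by (simp add: strict_mono_less)
    then have "j (Suc k) - 1 \<in> {j k..<j (Suc k)}" by auto
    from y[OF this] show "y (j (Suc k) - 1)" using mt(2) by (simp add: j_Suc)
  next
    fix x assume inf: "infinite {k. \<forall>i\<in>{j k..<j (Suc k)}. x i = y i}"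
    show "x \<notin> B"
    proof
      assume "x \<in> B"
      then obtain n where "x \<in> A n" using F(3) rangeA by (metis UnionE image_iff insertCI)
      obtain k where k: "k \<ge> n" "\<forall>i\<in>{j k..<j (Suc k)}. x i = y i"
        using inf unfolding infinite_nat_iff_unbounded_le by blast
      then have "x \<notin> D k" using mt(3)[of "j k" k x] y by (simp add: j_Suc)
      moreover have "A n \<subseteq> D k" using k(1) closure_subset[of "A n"] by (auto simp: D_def)
      ultimately show False using \<open>x \<in> A n\<close> by blast
    qed
  qed
qed

text \<open>The Baire category theorem for this space: \<open>y\<close> matches itself on every
  interval.\<close>

lemma meager_ex_not_mem:
  assumes "B \<in> meager_ideal"
  shows "\<exists>z. z \<notin> B"
proof (rule meager_avoiding_partition[OF assms])
  fix j and y :: cantor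
  assume "\<And>x. infinite {k. \<forall>i\<in>{j k..<j (Suc k)}. x i = y i} \<Longrightarrow> x \<notin> B"
  from this[of y] have "y \<notin> B" by simp
  then show ?thesis by blast
qed

text \<open>Translates domination of functions into inclusion of meager sets: the set grows with
  \<open>f\<close>.\<close>

definition short_gaps :: "(nat \<Rightarrow> nat) \<Rightarrow> cantor set" where
  "short_gaps f = (\<Union>k. {x. \<forall>n\<ge>k. \<exists>i\<in>{n..f n}. x i})"

lemma short_gaps_meager: "short_gaps f \<in> meager_ideal"
  unfolding short_gaps_def
proof (rule meager_idealI)
  fix k
  show "closed {x. \<forall>n\<ge>k. \<exists>i\<in>{n..f n}. x i}"
    unfolding closed_cantor_iff
  proof (intro allI impI)
    fix x assume "x \<notin> {x. \<forall>n\<ge>k. \<exists>i\<in>{n..f n}. x i}"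
    then obtain n where "n \<ge> k" "\<forall>i\<in>{n..f n}. \<not> x i" by blast
    then show "\<exists>m. \<forall>y. (\<forall>i<m. y i = x i) \<longrightarrow> y \<notin> {x. \<forall>n\<ge>k. \<exists>i\<in>{n..f n}. x i}"
      by (intro exI[of _ "Suc (f n)"]) fastforce
  qed
next
  fix k n and w :: cantor
  show "\<exists>x. (\<forall>i<n. x i = w i) \<and> x \<notin> {x. \<forall>n\<ge>k. \<exists>i\<in>{n..f n}. x i}"
    by (intro exI[of _ "\<lambda>i. i < n \<and> w i"]) (auto intro!: exI[of _ "max k n"])
qed

text \<open>The bound is \<open>j (Suc n)\<close>. If \<open>f\<close> jumped over the whole
  \<open>k\<close>-th interval from its start for infinitely many \<open>k\<close>, a point of
  \<open>short_gaps f\<close> could match \<open>y\<close> on all of these and so leave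
  \<open>B\<close>. Otherwise \<open>f n\<close> is at most \<open>f (j n)\<close>, which is below
  \<open>j (Suc n)\<close> for large \<open>n\<close>.\<close>

lemma short_gaps_subset_imp_dominated:
  assumes "B \<in> meager_ideal"
  shows "\<exists>h::nat \<Rightarrow> nat. \<forall>f. mono f \<longrightarrow> (\<forall>n. n \<le> f n) \<longrightarrow>
    short_gaps f \<subseteq> B \<longrightarrow> (\<exists>k. \<forall>n\<ge>k. f n \<le> h n)"
proof -
  obtain j and y :: cantor where j: "strict_mono j" "\<And>k. y (j (Suc k) - 1)"
    "\<And>x. infinite {k. \<forall>i\<in>{j k..<j (Suc k)}. x i = y i} \<Longrightarrow> x \<notin> B"
    using meager_avoiding_partition[OF assms] by blast
  have "\<exists>k. \<forall>n\<ge>k. f n \<le> j (Suc n)" if f: "mono f" "\<forall>n. n \<le> f n" "short_gaps f \<subseteq> B" for f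
  proof -
    define K where "K = {k. j (Suc k) \<le> f (j k)}"
    \<comment> \<open>\<open>x\<close> copies \<open>y\<close> on the intervals in \<open>K\<close>
      and is \<open>True\<close> elsewhere. Inside an interval in \<open>K\<close> its final
      \<open>True\<close> is reached by \<open>f n\<close>, so the gaps stay short.\<close>
    define x where "x i = (\<forall>k\<in>K. i \<in> {j k..<j (Suc k)} \<longrightarrow> y i)" for i
    have uniq: "k = l" if "i \<in> {j k..<j (Suc k)}" "i \<in> {j l..<j (Suc l)}" for i k l
    proof -
      have "j k < j (Suc l)" "j l < j (Suc k)" using that by auto
      then show ?thesis using j(1) by (simp add: strict_mono_less)
    qed
    have match: "x i = y i" if "k \<in> K" "i \<in> {j k..<j (Suc k)}" for i k
      using uniq[OF _ that(2)] that unfolding x_def by blast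
    have "\<exists>i\<in>{n..f n}. x i" for n
    proof (cases "x n")
      case True
      then show ?thesis using f(2) by auto
    next
      case False
      then obtain k where k: "k \<in> K" "n \<in> {j k..<j (Suc k)}" unfolding x_def by blast
      have "f (j k) \<le> f n" using f(1) k(2) by (auto intro: monoD)
      then have "j (Suc k) \<le> f n" using k(1) by (simp add: K_def)
      moreover have "x (j (Suc k) - 1)" using match[OF k(1), of "j (Suc k) - 1"] k(2) j(2) by auto
      ultimately show ?thesis using k(2) by (intro bexI[of _ "j (Suc k) - 1"]) auto
    qed
    then have "x \<in> B" using f(3) by (auto simp: short_gaps_def)
    then have "finite {k. \<forall>i\<in>{j k..<j (Suc k)}. x i = y i}" using j(3) by blast
    then have "finite K" by (rule rev_finite_subset) (use match in blast)
    then obtain k where k: "\<And>n. n \<in> K \<Longrightarrow> n < k"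
      using finite_nat_iff_bounded by (metis lessThan_iff subsetD)
    have "f n \<le> j (Suc n)" if "n \<ge> k" for n
    proof -
      have "f n \<le> f (j n)" using f(1) strict_mono_imp_increasing[OF j(1)] by (rule monoD)
      moreover have "n \<notin> K" using k[of n] that by auto
      ultimately show ?thesis by (simp add: K_def)
    qed
    then show ?thesis by blast
  qed
  then show ?thesis by (intro exI[of _ "\<lambda>n. j (Suc n)"]) simp
qed


section \<open>Matching on disjoint blocks\<close>

text \<open>Size \<open>m\<close> gives agreement the summable measure \<open>(1/2) ^ m\<close>;
  \<open>prod_encode\<close> places the block at or above \<open>m\<close>, so late blocks lie
  beyond any given prefix.\<close>

definition block :: "nat \<Rightarrow> nat set" where
  "block m = (\<lambda>i. prod_encode (m, i)) ` {..<m}"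

definition agrees :: "nat \<Rightarrow> cantor \<Rightarrow> cantor \<Rightarrow> bool" where
  "agrees m x z \<longleftrightarrow> (\<forall>i\<in>block m. x i = z i)"

lemma agrees_commute: "agrees m x z \<longleftrightarrow> agrees m z x"
  unfolding agrees_def by metis

lemma finite_block: "finite (block m)"
  by (simp add: block_def)

lemma card_block: "card (block m) = m"
  unfolding block_def by (subst card_image) (auto simp: inj_on_def)

lemma block_ge: "i \<in> block m \<Longrightarrow> m \<le> i"
  unfolding block_def using le_prod_encode_1 by auto

lemma agrees_clopen: "{x. agrees m x z} \<in> clopen_sets"
proof -
  obtain N where "block m \<subseteq> {..<N}" using finite_block finite_nat_iff_bounded by blast
  then show ?thesis by (intro clopen_cantorI[of N]) (auto simp: agrees_def subset_iff)
qed

lemma measure_agrees: "measure cantor_measure {x. agrees m x z} = (1/2) ^ m"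
  unfolding agrees_def using measure_cantor_agree[OF finite_block] by (simp add: card_block)

definition eventually_different :: "cantor \<Rightarrow> cantor set" where
  "eventually_different x = (\<Union>k. {z. \<forall>m\<ge>k. \<not> agrees m x z})"

text \<open>Any prefix of length \<open>n\<close> can be continued by \<open>x\<close> itself, which
  yields agreement on the block with index \<open>max k n\<close>.\<close>

lemma eventually_different_meager: "eventually_different x \<in> meager_ideal"
  unfolding eventually_different_def
proof (rule meager_idealI)
  fix k
  have "closed (- {z. agrees m z x})" for m
    using agrees_clopen by (auto simp: clopen_sets_def)
  then have "closed (\<Inter>m\<in>{k..}. - {z. agrees m z x})" by blast
  also have "(\<Inter>m\<in>{k..}. - {z. agrees m z x}) = {z. \<forall>m\<ge>k. \<not> agrees m x z}"
    by (auto simp: agrees_commute)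
  finally show "closed {z. \<forall>m\<ge>k. \<not> agrees m x z}" .
next
  fix k n and w :: cantor
  define z where "z i = (if i < n then w i else x i)" for i
  have "agrees (max k n) x z"
    unfolding agrees_def z_def using block_ge by fastforce
  then show "\<exists>z. (\<forall>i<n. z i = w i) \<and> z \<notin> {z. \<forall>m\<ge>k. \<not> agrees m x z}"
    by (intro exI[of _ z]) (auto simp: z_def intro!: exI[of _ "max k n"])
qed

text \<open>Limiting the search by \<open>h\<close> strengthens infinitely frequent agreement, a
  countable intersection of open conditions, to a countable union of closed ones.\<close>

definition boundedly_matching :: "cantor \<Rightarrow> (nat \<Rightarrow> nat) \<Rightarrow> cantor set" where
  "boundedly_matching z h = (\<Union>k. {x. \<forall>n\<ge>k. \<exists>m\<in>{n..h n}. agrees m x z})"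

lemma sum_half_powers_le: "(\<Sum>m=n..N. (1/2::real) ^ m) \<le> 2 * (1/2) ^ n"
proof (cases "n \<le> N")
  case True
  then have "(\<Sum>m=n..N. (1/2::real) ^ m) = 2 * (1/2) ^ n - (1/2) ^ N"
    by (induction rule: dec_induct) auto
  then show ?thesis by simp
qed simp

text \<open>For each \<open>n\<close> a finite union of clopen sets is required, whence closedness.
  The requirement at a single \<open>n\<close> already bounds the measure by a geometric tail, which
  is arbitrarily small.\<close>

lemma boundedly_matching_closed_null: "boundedly_matching z h \<in> closed_null_ideal"
proof -
  interpret prob_space cantor_measure by (rule prob_space_cantor_measure)
  define C where "C k = {x. \<forall>n\<ge>k. \<exists>m\<in>{n..h n}. agrees m x z}" for k
  have meas: "{x. agrees m x z} \<in> sets cantor_measure" for m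
    using agrees_clopen by (rule clopen_measurable)
  have closed: "closed (C k)" for k
  proof -
    have "closed (\<Inter>n\<in>{k..}. \<Union>m\<in>{n..h n}. {x. agrees m x z})"
      using agrees_clopen by (intro closed_INT ballI closed_UN) (auto simp: clopen_sets_def)
    also have "(\<Inter>n\<in>{k..}. \<Union>m\<in>{n..h n}. {x. agrees m x z}) = C k"
      by (auto simp: C_def)
    finally show ?thesis .
  qed
  have null: "C k \<in> null_sets cantor_measure" for k
  proof (rule null_setsI_measure_less)
    show "C k \<in> sets cantor_measure" using closed by (simp add: sets_cantor_measure)
    fix e :: real assume "e > 0"
    then obtain p where p: "(1/2::real) ^ p < e / 2" using real_arch_pow_inv[of "e/2" "1/2"] by auto
    define n where "n = max k p"
    have "measure cantor_measure (C k) \<le> measure cantor_measure (\<Union>m\<in>{n..h n}. {x. agrees m x z})"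
      using meas by (intro finite_measure_mono) (auto simp: C_def n_def)
    also have "\<dots> \<le> (\<Sum>m=n..h n. measure cantor_measure {x. agrees m x z})"
      using meas by (intro finite_measure_subadditive_finite) auto
    also have "\<dots> \<le> 2 * (1/2) ^ n"
      using sum_half_powers_le by (simp add: measure_agrees)
    also have "\<dots> \<le> 2 * (1/2) ^ p"
      by (simp add: n_def power_decreasing)
    finally show "measure cantor_measure (C k) < e" using p by simp
  qed
  show ?thesis
    unfolding boundedly_matching_def using closed null
    by (intro closed_null_idealI[of C]) (auto simp: C_def)
qed

definition next_match :: "cantor \<Rightarrow> cantor \<Rightarrow> nat \<Rightarrow> nat" where
  "next_match z x n = (LEAST m. n \<le> m \<and> agrees m x z)"

lemma next_match:
  assumes "z \<notin> eventually_different x"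
  shows "n \<le> next_match z x n" "agrees (next_match z x n) x z"
proof -
  have "\<exists>m. n \<le> m \<and> agrees m x z" using assms by (auto simp: eventually_different_def)
  from LeastI_ex[OF this] show "n \<le> next_match z x n" "agrees (next_match z x n) x z"
    by (simp_all add: next_match_def)
qed

lemma mono_next_match:
  assumes "z \<notin> eventually_different x"
  shows "mono (next_match z x)"
proof (rule monoI)
  fix n n' :: nat assume "n \<le> n'"
  then have "n \<le> next_match z x n' \<and> agrees (next_match z x n') x z"
    using next_match[OF assms, of n'] by simp
  then show "next_match z x n \<le> next_match z x n'"
    unfolding next_match_def[of z x n] by (rule Least_le)
qed

lemma boundedly_matchingI:
  assumes "z \<notin> eventually_different x" "\<forall>n\<ge>k. next_match z x n \<le> h n"
  shows "x \<in> boundedly_matching z h"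
proof -
  have "\<exists>m\<in>{n..h n}. agrees m x z" if "n \<ge> k" for n
    using next_match[OF assms(1), of n] assms(2) that by (intro bexI[of _ "next_match z x n"]) auto
  then show ?thesis unfolding boundedly_matching_def by blast
qed


section \<open>Additivity and cofinality of the meager ideal\<close>

text \<open>Fixing the choices as functions of the meager sets alone makes the resulting closed null
  covers depend only on a pair of meager sets, not on the point to be covered.\<close>

definition avoider :: "cantor set \<Rightarrow> cantor" where
  "avoider B = (SOME z. z \<notin> B)"

lemma avoider_not_mem: "B \<in> meager_ideal \<Longrightarrow> avoider B \<notin> B"
  unfolding avoider_def by (rule someI_ex[OF meager_ex_not_mem])

definition dominator :: "cantor set \<Rightarrow> nat \<Rightarrow> nat" where
  "dominator B = (SOME h. \<forall>f. mono f \<longrightarrow> (\<forall>n. n \<le> f n) \<longrightarrow>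
    short_gaps f \<subseteq> B \<longrightarrow> (\<exists>k. \<forall>n\<ge>k. f n \<le> h n))"

lemma dominator:
  assumes "B \<in> meager_ideal" "mono f" "\<forall>n. n \<le> f n" "short_gaps f \<subseteq> B"
  shows "\<exists>k. \<forall>n\<ge>k. f n \<le> dominator B n"
  using someI_ex[OF short_gaps_subset_imp_dominated[OF assms(1)]] assms(2-4)
  unfolding dominator_def by blast

text \<open>The common core of both bounds: \<open>B\<close> and \<open>B'\<close> are unions over
  \<open>X\<close> for the additivity, and members of a cofinal family for the cofinality.\<close>

lemma mem_boundedly_matching:
  assumes "B \<in> meager_ideal" "eventually_different x \<subseteq> B"
    and "B' \<in> meager_ideal" "short_gaps (next_match (avoider B) x) \<subseteq> B'"
  shows "x \<in> boundedly_matching (avoider B) (dominator B')"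
proof -
  have z: "avoider B \<notin> eventually_different x" using avoider_not_mem assms(1,2) by blast
  have "\<exists>k. \<forall>n\<ge>k. next_match (avoider B) x n \<le> dominator B' n"
    using dominator[OF assms(3) mono_next_match[OF z] _ assms(4)] next_match(1)[OF z] by blast
  then show ?thesis using boundedly_matchingI[OF z] by blast
qed

text \<open>If \<open>X\<close> is smaller than the additivity, unions of meager sets indexed by
  \<open>X\<close> are meager. This is used twice, the second time with \<open>avoider B\<close>
  already fixed, and traps \<open>X\<close> in one set of the ideal.\<close>

lemma add_meager_le_card_not_closed_null:
  assumes "X \<notin> closed_null_ideal"
  shows "add_card meager_ideal \<le>o |X|"
proof (rule ccontr)
  assume less: "\<not> add_card meager_ideal \<le>o |X|"
  have union: "(\<Union>x\<in>X. \<phi> x) \<in> meager_ideal" if "\<And>x. \<phi> x \<in> meager_ideal" for \<phi>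
  proof (rule ccontr)
    assume "(\<Union>x\<in>X. \<phi> x) \<notin> meager_ideal"
    then have "add_card meager_ideal \<le>o |\<phi> ` X|"
      unfolding add_card_def using that by (intro min_card_ordLeq) auto
    also have "|\<phi> ` X| \<le>o |X|" by (rule card_of_image)
    finally show False using less by blast
  qed
  define B where "B = (\<Union>x\<in>X. eventually_different x)"
  have B: "B \<in> meager_ideal" unfolding B_def by (rule union[OF eventually_different_meager])
  define B' where "B' = (\<Union>x\<in>X. short_gaps (next_match (avoider B) x))"
  have B': "B' \<in> meager_ideal" unfolding B'_def by (rule union[OF short_gaps_meager])
  have "X \<subseteq> boundedly_matching (avoider B) (dominator B')"
  proof
    fix x assume "x \<in> X"
    then show "x \<in> boundedly_matching (avoider B) (dominator B')"
      by (intro mem_boundedly_matching[OF B _ B']) (auto simp: B_def B'_def)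
  qed
  then show False
    using assms closed_null_ideal_subset[OF boundedly_matching_closed_null] by blast
qed

lemma cov_closed_null_le_cof_meager: "cov_card closed_null_ideal \<le>o cof_card meager_ideal"
  unfolding cof_card_def
proof (rule ordLeq_min_card)
  show "{F. F \<subseteq> meager_ideal \<and> (\<forall>A\<in>meager_ideal. \<exists>B\<in>F. A \<subseteq> B)} \<noteq> {}" by blast
next
  fix F assume "F \<in> {F. F \<subseteq> meager_ideal \<and> (\<forall>A\<in>meager_ideal. \<exists>B\<in>F. A \<subseteq> B)}"
  then have F: "\<And>B. B \<in> F \<Longrightarrow> B \<in> meager_ideal"
    and cof: "\<And>A. A \<in> meager_ideal \<Longrightarrow> \<exists>B\<in>F. A \<subseteq> B" by auto
  \<comment> \<open>Needed for \<open>F \<times> F\<close> to have the size of \<open>F\<close>. If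
    \<open>F\<close> were finite, the finite meager set of all its avoiders would lie in some
    \<open>B\<close> of \<open>F\<close>, contradicting the choice of
    \<open>avoider B\<close>.\<close>
  have inf: "infinite F"
  proof
    assume "finite F"
    then obtain B where "B \<in> F" "avoider ` F \<subseteq> B" using cof[OF finite_meager] by blast
    then show False using avoider_not_mem[OF F] by blast
  qed
  define G where "G = (\<lambda>(B, B'). boundedly_matching (avoider B) (dominator B')) ` (F \<times> F)"
  have "x \<in> \<Union>G" for x
  proof -
    obtain B where B: "B \<in> F" "eventually_different x \<subseteq> B"
      using cof[OF eventually_different_meager] by blast
    obtain B' where B': "B' \<in> F" "short_gaps (next_match (avoider B) x) \<subseteq> B'"
      using cof[OF short_gaps_meager] by blast
    have "x \<in> boundedly_matching (avoider B) (dominator B')"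
      by (rule mem_boundedly_matching[OF F[OF B(1)] B(2) F[OF B'(1)] B'(2)])
    then show ?thesis using B(1) B'(1) by (auto simp: G_def)
  qed
  then have "cov_card closed_null_ideal \<le>o |G|"
    unfolding cov_card_def
    by (intro min_card_ordLeq) (auto simp: G_def boundedly_matching_closed_null)
  also have "|G| \<le>o |F \<times> F|" unfolding G_def by (rule card_of_image)
  also have "|F \<times> F| =o |F|" using inf by (rule card_of_Times_same_infinite)
  finally show "cov_card closed_null_ideal \<le>o |F|" .
qed

section \<open>Assembling the two chains of inequalities\<close>

theorem theorem5p6:
  fixes J :: "nat set set"
  assumes "ideal_on_omega J"
  shows
    "cov_card null_ideal \<le>o cov_card (NJ J) \<and>
     cov_card (NJ J) \<le>o cov_card (NJ_star J) \<and>
     cov_card (NJ_star J) \<le>o cov_card closed_null_ideal \<and>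
     cov_card closed_null_ideal \<le>o cmin (cof_card meager_ideal) reaping_number \<and>
     cmax (add_card meager_ideal) splitting_number \<le>o non_card closed_null_ideal \<and>
     non_card closed_null_ideal \<le>o non_card (NJ_star J) \<and>
     non_card (NJ_star J) \<le>o non_card (NJ J) \<and>
     non_card (NJ J) \<le>o non_card null_ideal"
proof -
  note inclusions = NJ_subset_null_ideal[OF assms] NJ_star_subset_NJ[OF assms]
    closed_null_ideal_subset_NJ_star[OF assms]
  \<comment> \<open>The cover by singletons lies in the smallest of the four families, so it serves
    all three comparisons of covering numbers.\<close>
  define F :: "cantor set set" where "F = range (\<lambda>x. {x})"
  have F: "F \<subseteq> closed_null_ideal" "\<Union>F = UNIV"
    unfolding F_def using singleton_closed_null by auto
  have UNIV: "UNIV \<notin> null_ideal" "UNIV \<notin> NJ J" "UNIV \<notin> NJ_star J" "UNIV \<notin> closed_null_ideal"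
    using UNIV_not_null inclusions by blast+
  have "cov_card null_ideal \<le>o cov_card (NJ J)" "cov_card (NJ J) \<le>o cov_card (NJ_star J)"
    "cov_card (NJ_star J) \<le>o cov_card closed_null_ideal"
    using inclusions F by (auto intro!: cov_card_antimono[where F = F])
  moreover have "non_card closed_null_ideal \<le>o non_card (NJ_star J)"
    "non_card (NJ_star J) \<le>o non_card (NJ J)" "non_card (NJ J) \<le>o non_card null_ideal"
    using inclusions UNIV by (auto intro!: non_card_mono)
  moreover have "cov_card closed_null_ideal \<le>o cmin (cof_card meager_ideal) reaping_number"
    using cov_closed_null_le_cof_meager cov_closed_null_le_reaping
    by (subst ordLeq_cmin_iff) (simp_all add: cof_card_def reaping_number_def Card_order_min_card)
  moreover have "add_card meager_ideal \<le>o non_card closed_null_ideal"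
    "splitting_number \<le>o non_card closed_null_ideal"
    unfolding non_card_def using UNIV(4)
    by (auto intro!: ordLeq_min_card add_meager_le_card_not_closed_null splitting_le_card_not_closed_null)
  then have "cmax (add_card meager_ideal) splitting_number \<le>o non_card closed_null_ideal"
    by (subst cmax_ordLeq_iff) (simp_all add: add_card_def splitting_number_def Card_order_min_card)
  ultimately show ?thesis by blast
qed

end
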